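(* Let $n\ge r\ge 1$ and $r\le s<n$ be integers, let $\Omega\subset\mathbb{R}^d$ be a bounded set, and let $A(p)\in\mathbb{R}^{n\times n}$ and $b(p)\in\mathbb{R}^n$ be given for each $p\in\Omega$. Let $Q_X\in\mathbb{R}^{n\times r}$ have orthonormal columns, put $B(p)=A(p)Q_X$, and let $S\in\mathbb{R}^{s\times n}$ be a subsampling matrix. Fix $p_0\in\Omega$ such that $A(p_0)Q_X$ has full column rank, and let $B(p_0)=A(p_0)Q_X=U(p_0)H(p_0)$ be its polar decomposition. Let $p_*\in\Omega$ and $\delta$ be such that $\|A(p_* )-A(p_0)\|_2\le\delta$, and let $$c(p_* )=\operatorname{argmin}_{c\in\mathbb{R}^r}\|B(p_* )c-b(p_* )\|_2,\qquad \hat c(p_* )=\operatorname{argmin}_{\hat c\in\mathbb{R}^r}\|S(B(p_* )\hat c-b(p_* ))\|_2 .$$ Define $$C=\frac{3}{\sigma_{\min}(A(p_0)Q_X)} .$$ Provided that $\sigma_{\min}(SU(p_0))>C\delta$, we have $$\frac{\|B(p_* )\hat c(p_* )-b(p_* )\|_2}{\|B(p_* )c(p_* )-b(p_* )\|_2}\le\frac{1}{\sigma_{\min}(SU(p_0))-C\delta}.$$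
   Context: $\|\cdot\|_2$ is the operator (spectral) norm of a matrix or the Euclidean norm of a vector. For a matrix $M$ with $r$ columns and at least $r$ rows, $\sigma_{\min}(M)=\sigma_r(M)$ is its smallest ($r$-th largest) singular value. A subsampling matrix $S\in\mathbb{R}^{s\times n}$ is a row-submatrix of the identity $I_n$: it consists of $s$ distinct rows of $I_n$, so each row has exactly one entry equal to $1$ and zeros elsewhere. The polar decomposition of $B\in\mathbb{R}^{n\times r}$ ($n\ge r$) is $B=UH$ with $U\in\mathbb{R}^{n\times r}$ having orthonormal columns and $H\in\mathbb{R}^{r\times r}$ symmetric positive semidefinite; if $B$ has full column rank, it is unique. A bound $\frac{x}{y}\le K$ on a ratio of residual norms is to be read as $x\le Ky$ when $y=0$. *)

theory Defs
  imports "HOL-Analysis.Analysis"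
begin

text \<open>
  Matrices and vectors are indexed by finite types, so that an $m \times k$ real matrix is a
  \<open>real^'k^'m\<close> with \<open>m = CARD('m)\<close> and \<open>k = CARD('k)\<close>. The spectral norm of \<open>M\<close> is the library's
  operator norm \<open>onorm ((*v) M)\<close> with respect to Euclidean norms.
\<close>

text \<open>
  The singular values of \<open>M\<close> are the square roots of the eigenvalues of \<open>M\<^sup>T M\<close>. They are
  collected as a set, without multiplicities, which is immaterial for the smallest one.
  If \<open>M\<close> has \<open>r\<close> columns and at least \<open>r\<close> rows, \<open>M\<^sup>T M\<close> is \<open>r \<times> r\<close> and the minimum is the
  \<open>r\<close>-th largest singular value.
\<close>

definition singular_values :: "real^'k^'m \<Rightarrow> real set" where
  "singular_values M =
     {\<sigma>. 0 \<le> \<sigma> \<and> (\<exists>v. v \<noteq> 0 \<and> (transpose M ** M) *v v = \<sigma>\<^sup>2 *\<^sub>R v)}"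

definition sigma_min :: "real^'k^'m \<Rightarrow> real" where
  "sigma_min M = Min (singular_values M)"

definition orthonormal_columns :: "real^'k^'m \<Rightarrow> bool" where
  "orthonormal_columns Q \<longleftrightarrow> transpose Q ** Q = mat 1"

definition full_column_rank :: "real^'k^'m \<Rightarrow> bool" where
  "full_column_rank M \<longleftrightarrow> rank M = CARD('k)"

definition subsampling_matrix :: "real^'n^'s \<Rightarrow> bool" where
  "subsampling_matrix S \<longleftrightarrow>
     (\<exists>f :: 's \<Rightarrow> 'n. inj f \<and> (\<forall>i. row i S = row (f i) (mat 1 :: real^'n^'n)))"

definition symmetric_psd :: "real^'k^'k \<Rightarrow> bool" where
  "symmetric_psd H \<longleftrightarrow> transpose H = H \<and> (\<forall>x. 0 \<le> x \<bullet> (H *v x))"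

definition polar_decomposition :: "real^'k^'m \<Rightarrow> real^'k^'m \<Rightarrow> real^'k^'k \<Rightarrow> bool" where
  "polar_decomposition B U H \<longleftrightarrow>
     B = U ** H \<and> orthonormal_columns U \<and> symmetric_psd H"

text \<open>
  The set of singular values is finite and nonempty, so \<open>Min\<close> in the definition of \<open>sigma_min\<close>
  is a genuine minimum.
\<close>

lemma gram_inner:
  fixes M :: "real^'k^'m"
  shows "((transpose M ** M) *v x) \<bullet> y = (M *v x) \<bullet> (M *v y)"
  by (metis dot_lmul_matrix inner_commute matrix_vector_mul_assoc transpose_matrix_vector)

lemma finite_singular_values: "finite (singular_values (M :: real^'k^'m))"
proof -
  let ?G = "transpose M ** M"
  define v where "v \<sigma> = (SOME v. v \<noteq> 0 \<and> ?G *v v = \<sigma>\<^sup>2 *\<^sub>R v)" for \<sigma>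
  have v: "v \<sigma> \<noteq> 0 \<and> ?G *v v \<sigma> = \<sigma>\<^sup>2 *\<^sub>R v \<sigma>" if "\<sigma> \<in> singular_values M" for \<sigma>
    unfolding v_def by (rule someI_ex) (use that in \<open>auto simp: singular_values_def\<close>)
  have orth: "v \<sigma> \<bullet> v \<tau> = 0"
    if "\<sigma> \<in> singular_values M" "\<tau> \<in> singular_values M" "\<sigma> \<noteq> \<tau>" for \<sigma> \<tau>
  proof -
    have "(?G *v v \<sigma>) \<bullet> v \<tau> = (?G *v v \<tau>) \<bullet> v \<sigma>"
      using gram_inner[of M] by (metis inner_commute)
    then have "\<sigma>\<^sup>2 * (v \<sigma> \<bullet> v \<tau>) = \<tau>\<^sup>2 * (v \<sigma> \<bullet> v \<tau>)"
      using v[OF that(1)] v[OF that(2)] by (simp add: inner_commute)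
    moreover have "\<sigma>\<^sup>2 \<noteq> \<tau>\<^sup>2"
      using that by (auto simp: singular_values_def power2_eq_iff_nonneg)
    ultimately show ?thesis by simp
  qed
  have inj: "inj_on v (singular_values M)"
    by (rule inj_onI) (metis orth v inner_eq_zero_iff)
  have "independent (v ` singular_values M)"
    by (rule pairwise_orthogonal_independent)
      (use v orth in \<open>auto simp: pairwise_def orthogonal_def\<close>)
  then have "finite (v ` singular_values M)"
    by (rule independent_imp_finite)
  then show ?thesis
    using inj by (rule finite_imageD)
qed

lemma singular_values_nonempty: "singular_values (M :: real^'k^'m) \<noteq> {}"
proof -
  let ?G = "transpose M ** M"
  have "sphere (0 :: real^'k) 1 \<noteq> {}" by simp
  moreover have "continuous_on (sphere 0 1) (\<lambda>x. norm (M *v x))"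
    by (intro continuous_intros)
  ultimately obtain v where v: "norm v = 1"
    and least: "\<And>x. norm x = 1 \<Longrightarrow> norm (M *v v) \<le> norm (M *v x)"
    using continuous_attains_inf[OF compact_sphere, of 0 1 "\<lambda>x. norm (M *v x)"] by auto
  define \<sigma> where "\<sigma> = norm (M *v v)"
  have ge: "\<sigma> * norm x \<le> norm (M *v x)" for x
  proof (cases "x = 0")
    case False
    have "\<sigma> \<le> norm (M *v ((1 / norm x) *\<^sub>R x))"
      unfolding \<sigma>_def using False by (intro least) simp
    also have "\<dots> = norm (M *v x) / norm x"
      by (simp add: matrix_vector_mult_scaleR)
    finally show ?thesis
      using False by (simp add: field_simps)
  qed simp
  have \<sigma>0: "0 \<le> \<sigma>" by (simp add: \<sigma>_def)
  define q where "q x = (norm (M *v x))\<^sup>2 - \<sigma>\<^sup>2 * (norm x)\<^sup>2" for x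
  have q0: "0 \<le> q x" for x
    using power_mono[OF ge[of x], of 2] \<sigma>0 by (simp add: q_def power_mult_distrib)
  define w where "w = ?G *v v - \<sigma>\<^sup>2 *\<^sub>R v"
  have qt: "q (v - t *\<^sub>R w) = t\<^sup>2 * q w - 2 * t * (w \<bullet> w)" for t
  proof -
    have vw: "(M *v v) \<bullet> (M *v w) = w \<bullet> w + \<sigma>\<^sup>2 * (v \<bullet> w)"
      by (simp add: gram_inner[symmetric] w_def inner_diff_left)
    have vv: "(M *v v) \<bullet> (M *v v) = \<sigma>\<^sup>2 * (v \<bullet> v)"
      using v by (simp add: \<sigma>_def flip: power2_norm_eq_inner)
    have "q (v - t *\<^sub>R w) =
        (M *v v) \<bullet> (M *v v) - 2 * t * ((M *v v) \<bullet> (M *v w)) + t\<^sup>2 * ((M *v w) \<bullet> (M *v w))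
        - \<sigma>\<^sup>2 * (v \<bullet> v - 2 * t * (v \<bullet> w) + t\<^sup>2 * (w \<bullet> w))"
      unfolding q_def power2_norm_eq_inner
      by (simp add: matrix_vector_mult_diff_distrib matrix_vector_mult_scaleR
          inner_diff_left inner_diff_right inner_commute power2_eq_square algebra_simps)
    also have "\<dots> = t\<^sup>2 * q w - 2 * t * (w \<bullet> w)"
      unfolding vv vw q_def power2_norm_eq_inner by (simp add: algebra_simps)
    finally show ?thesis .
  qed
  have "w \<bullet> w = 0"
  proof (rule ccontr)
    assume "w \<bullet> w \<noteq> 0"
    then have pos: "0 < w \<bullet> w" by simp
    define t where "t = (w \<bullet> w) / (q w + 1)"
    have t: "0 < t" using pos q0[of w] by (simp add: t_def add_nonneg_pos)
    have "t * q w < 2 * (w \<bullet> w)"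
    proof -
      have "t * (q w + 1) = w \<bullet> w" using q0[of w] by (simp add: t_def)
      then have "t * q w + t = w \<bullet> w" by (simp only: distrib_left mult_1_right)
      then show ?thesis using t pos by linarith
    qed
    then have "t * (t * q w - 2 * (w \<bullet> w)) < 0"
      using t by (simp add: mult_pos_neg)
    then have "q (v - t *\<^sub>R w) < 0"
      unfolding qt by (simp add: algebra_simps power2_eq_square)
    then show False using q0 by (meson not_le)
  qed
  then have "?G *v v = \<sigma>\<^sup>2 *\<^sub>R v" by (simp add: w_def)
  moreover have "v \<noteq> 0" using v by auto
  ultimately have "\<sigma> \<in> singular_values M"
    using \<sigma>0 by (auto simp: singular_values_def)
  then show ?thesis by blast
qed

end

theory Submission imports Defs begin

text \<open>
  Write \<open>\<rho> = B(p\<^sub>*) c - b(p\<^sub>*)\<close> for the optimal residual and \<open>y = B(p\<^sub>*) (c_hat - c)\<close>, so that the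
  subsampled solution has residual \<open>y + \<rho>\<close>. The normal equations of the two least squares problems
  say \<open>y \<bottom> \<rho>\<close> and \<open>S y \<bottom> S (y + \<rho>)\<close>. Let \<open>s\<close> be a constant with
  \<open>s \<parallel>z\<parallel> \<le> \<parallel>S z\<parallel>\<close> for all \<open>z\<close> in the range of \<open>B(p\<^sub>*)\<close>. The residual \<open>y + \<rho>\<close> is the image of \<open>\<rho>\<close>
  under \<open>I - P\<close>, with \<open>P\<close> the oblique projector onto that range given by the subsampled problem,
  and a nontrivial projector and its complement have the same norm; this is why the factor is \<open>1 / s\<close>, with
  no loss such as \<open>1 + 1 / s\<close>. The lemma \<open>sketched_residual_le\<close> extracts this from a
  single test vector in the plane spanned by \<open>y\<close> and \<open>\<rho>\<close>.

  It remains to take \<open>s = \<sigma>\<^sub>m\<^sub>i\<^sub>n(S U(p\<^sub>0)) - C \<delta>\<close> (lemma \<open>contraction_lower_bound_perturbed\<close>).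
  At \<open>p\<^sub>0\<close> the range of \<open>B\<close> is that of \<open>U(p\<^sub>0)\<close>, where the bound holds with
  \<open>\<sigma> = \<sigma>\<^sub>m\<^sub>i\<^sub>n(S U(p\<^sub>0)) \<le> 1\<close>. Passing to \<open>p\<^sub>*\<close> moves \<open>B x\<close> by at most \<open>\<delta> \<parallel>x\<parallel>\<close>, which
  costs \<open>(1 + \<sigma>) \<delta> \<parallel>x\<parallel> \<le> 2 \<delta> \<parallel>x\<parallel>\<close>. Writing \<open>m = \<sigma>\<^sub>m\<^sub>i\<^sub>n(B(p\<^sub>0))\<close>, the hypothesis
  forces \<open>\<delta> < m / 3\<close>, hence \<open>\<parallel>B(p\<^sub>*) x\<parallel> \<ge> (m - \<delta>) \<parallel>x\<parallel> \<ge> (2 m / 3) \<parallel>x\<parallel>\<close>, and the loss is at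
  most \<open>(3 \<delta> / m) \<parallel>B(p\<^sub>*) x\<parallel>\<close>: the constant 3 is \<open>2 / (2 / 3)\<close>.
\<close>

text \<open>
  The first-order optimality condition along a line, used for both the Rayleigh quotient and the
  least squares problems.
\<close>

lemma nonneg_quadratic_imp_linear_coeff_0:
  fixes \<beta> \<gamma> :: real
  assumes "\<And>t. 0 \<le> 2 * t * \<beta> + t\<^sup>2 * \<gamma>"
  shows "\<beta> = 0"
proof (rule ccontr)
  assume "\<beta> \<noteq> 0"
  define k where "k = \<bar>\<gamma>\<bar> + 1"
  have k: "0 < k" "\<gamma> < k" by (auto simp: k_def)
  \<comment> \<open>Near 0 the linear term dominates: a step \<open>-\<beta> / k\<close> against its sign, with \<open>k\<close> above the
    curvature, makes the quadratic negative.\<close>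
  have "0 \<le> 2 * (- \<beta> / k) * \<beta> + (- \<beta> / k)\<^sup>2 * \<gamma>" by (rule assms)
  also have "\<dots> = \<beta>\<^sup>2 / k\<^sup>2 * (\<gamma> - 2 * k)"
    using k by (simp add: field_simps power2_eq_square)
  also have "\<dots> < 0"
    using k \<open>\<beta> \<noteq> 0\<close> by (intro mult_pos_neg) auto
  finally show False by simp
qed

lemma power2_norm_add_scaleR:
  fixes a b :: "'a::real_inner"
  shows "(norm (a + t *\<^sub>R b))\<^sup>2 = (norm a)\<^sup>2 + 2 * t * (a \<bullet> b) + t\<^sup>2 * (norm b)\<^sup>2"
  unfolding power2_norm_eq_inner
  by (simp add: inner_add_left inner_add_right inner_commute[of b a] power2_eq_square
      algebra_simps)

lemma sigma_min_mem: "sigma_min M \<in> singular_values M"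
  unfolding sigma_min_def by (intro Min_in finite_singular_values singular_values_nonempty)

text \<open>
  The minimum \<open>\<mu>\<close> of \<open>\<parallel>M x\<parallel>\<close> over the unit sphere is attained, at \<open>v\<close> say. The form
  \<open>\<parallel>M x\<parallel>\<^sup>2 - \<mu>\<^sup>2 \<parallel>x\<parallel>\<^sup>2\<close> is positive semidefinite and vanishes at \<open>v\<close>, so \<open>v\<close> lies in its
  kernel; that is, \<open>v\<close> is an eigenvector of \<open>M\<^sup>T M\<close> and \<open>\<mu>\<close> is a singular value.
\<close>

lemma sigma_min_norm_le:
  fixes M :: "real^'k^'m"
  shows "sigma_min M * norm x \<le> norm (M *v x)"
proof -
  have "continuous_on (sphere 0 1) (\<lambda>x. norm (M *v x))"
    by (intro continuous_intros)
  then obtain v where v: "norm v = 1"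
    and least: "\<And>x. norm x = 1 \<Longrightarrow> norm (M *v v) \<le> norm (M *v x)"
    using continuous_attains_inf[OF compact_sphere, of 0 1 "\<lambda>x. norm (M *v x)"] by auto
  define \<mu> where "\<mu> = norm (M *v v)"
  have ge: "\<mu> * norm x \<le> norm (M *v x)" for x
  proof (cases "x = 0")
    case False
    have "\<mu> \<le> norm (M *v ((1 / norm x) *\<^sub>R x))"
      unfolding \<mu>_def using False by (intro least) simp
    also have "\<dots> = norm (M *v x) / norm x"
      by (simp add: matrix_vector_mult_scaleR)
    finally show ?thesis using False by (simp add: field_simps)
  qed simp
  have kernel: "((transpose M ** M) *v v - \<mu>\<^sup>2 *\<^sub>R v) \<bullet> u = 0" for u
  proof (rule nonneg_quadratic_imp_linear_coeff_0)
    fix t :: real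
    have "(\<mu> * norm (v + t *\<^sub>R u))\<^sup>2 \<le> (norm (M *v (v + t *\<^sub>R u)))\<^sup>2"
      by (intro power_mono ge) (simp add: \<mu>_def)
    also have "\<dots> = \<mu>\<^sup>2 + 2 * t * ((M *v v) \<bullet> (M *v u)) + t\<^sup>2 * (norm (M *v u))\<^sup>2"
      by (simp add: matrix_vector_right_distrib matrix_vector_mult_scaleR \<mu>_def
          power2_norm_add_scaleR)
    also have "(\<mu> * norm (v + t *\<^sub>R u))\<^sup>2
        = \<mu>\<^sup>2 * (1 + 2 * t * (v \<bullet> u) + t\<^sup>2 * (norm u)\<^sup>2)"
      by (simp add: power_mult_distrib power2_norm_add_scaleR v)
    finally show "0 \<le> 2 * t * (((transpose M ** M) *v v - \<mu>\<^sup>2 *\<^sub>R v) \<bullet> u)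
        + t\<^sup>2 * ((norm (M *v u))\<^sup>2 - \<mu>\<^sup>2 * (norm u)\<^sup>2)"
      by (simp add: inner_diff_left gram_inner algebra_simps)
  qed
  have "(transpose M ** M) *v v = \<mu>\<^sup>2 *\<^sub>R v"
    using kernel[of "(transpose M ** M) *v v - \<mu>\<^sup>2 *\<^sub>R v"] by simp
  moreover have "v \<noteq> 0" using v by auto
  moreover have "0 \<le> \<mu>" by (simp add: \<mu>_def)
  ultimately have "\<mu> \<in> singular_values M"
    by (auto simp: singular_values_def)
  then have "sigma_min M \<le> \<mu>"
    unfolding sigma_min_def by (intro Min_le finite_singular_values)
  then have "sigma_min M * norm x \<le> \<mu> * norm x"
    by (intro mult_right_mono) auto
  with ge[of x] show ?thesis by linarith
qed

lemma sigma_min_pos: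
  fixes M :: "real^'k^'m"
  assumes "full_column_rank M"
  shows "0 < sigma_min M"
proof -
  obtain v where v: "v \<noteq> 0" "(transpose M ** M) *v v = (sigma_min M)\<^sup>2 *\<^sub>R v"
    and nonneg: "0 \<le> sigma_min M"
    using sigma_min_mem[of M] by (auto simp: singular_values_def)
  have "inj ((*v) M)"
    using assms by (simp add: full_column_rank_def full_rank_injective)
  then have "M *v v \<noteq> 0"
    using v(1) by (metis injD matrix_vector_mult_0_right)
  moreover have "(sigma_min M)\<^sup>2 * (v \<bullet> v) = (M *v v) \<bullet> (M *v v)"
    using gram_inner[of M v v] v(2) by simp
  ultimately have "sigma_min M \<noteq> 0" by auto
  with nonneg show ?thesis by simp
qed

lemma sigma_min_le_1:
  fixes M :: "real^'k^'m"
  assumes "\<And>x. norm (M *v x) \<le> norm x"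
  shows "sigma_min M \<le> 1"
  using order_trans[OF sigma_min_norm_le[of M "axis undefined 1"] assms] by simp

lemma norm_orthonormal_columns:
  assumes "orthonormal_columns U"
  shows "norm (U *v x) = norm x"
  using assms gram_inner[of U x x] by (simp add: orthonormal_columns_def norm_eq_sqrt_inner)

lemma norm_subsampling_matrix_le:
  fixes S :: "real^'n^'s"
  assumes "subsampling_matrix S"
  shows "norm (S *v x) \<le> norm x"
proof -
  obtain f :: "'s \<Rightarrow> 'n" where f: "inj f" "\<And>i. row i S = row (f i) (mat 1 :: real^'n^'n)"
    using assms by (auto simp: subsampling_matrix_def)
  have entry: "(S *v x) $ i = x $ f i" for i
  proof -
    have "(S *v x) $ i = row i S \<bullet> x"
      by (simp add: matrix_vector_mul_component row_def vec_lambda_eta)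
    also have "\<dots> = ((mat 1 :: real^'n^'n) *v x) $ f i"
      unfolding f(2) by (simp only: matrix_vector_mul_component row_def vec_lambda_eta)
    finally show ?thesis by simp
  qed
  have "(\<Sum>i\<in>UNIV. ((S *v x) $ i)\<^sup>2) = (\<Sum>j\<in>range f. (x $ j)\<^sup>2)"
    using f(1) by (simp add: entry sum.reindex)
  also have "\<dots> \<le> (\<Sum>j\<in>UNIV. (x $ j)\<^sup>2)"
    by (intro sum_mono2) auto
  finally show ?thesis by (simp add: norm_vec_def L2_set_def)
qed

lemma norm_matrix_vector_le:
  fixes M :: "real^'n^'m"
  assumes "onorm ((*v) M) \<le> \<delta>"
  shows "norm (M *v x) \<le> \<delta> * norm x"
  using order_trans[OF onorm[OF matrix_vector_mul_bounded_linear] mult_right_mono[OF assms]]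
  by simp

lemma least_squares_residual_orthogonal:
  fixes M :: "real^'k^'m"
  assumes "is_arg_min (\<lambda>x. norm (M *v x - b)) (\<lambda>_. True) c"
  shows "(M *v c - b) \<bullet> (M *v x) = 0"
proof (rule nonneg_quadratic_imp_linear_coeff_0)
  fix t :: real
  have "norm (M *v c - b) \<le> norm (M *v (c + t *\<^sub>R x) - b)"
    using assms by (auto simp: is_arg_min_def not_less)
  also have "M *v (c + t *\<^sub>R x) - b = (M *v c - b) + t *\<^sub>R (M *v x)"
    by (simp add: matrix_vector_right_distrib matrix_vector_mult_scaleR)
  finally have "(norm (M *v c - b))\<^sup>2 \<le> (norm ((M *v c - b) + t *\<^sub>R (M *v x)))\<^sup>2"
    by (intro power_mono) auto
  then show "0 \<le> 2 * t * ((M *v c - b) \<bullet> (M *v x)) + t\<^sup>2 * (norm (M *v x))\<^sup>2"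
    unfolding power2_norm_add_scaleR by linarith
qed

text \<open>
  The sharp factor \<open>1 / s\<close> comes from testing the contraction \<open>f\<close> on a vector \<open>w\<close> in the plane of
  \<open>y\<close> and \<open>\<rho>\<close> that is perpendicular to \<open>y + \<rho>\<close>. Since \<open>f y \<bottom> f (y + \<rho>)\<close>, the component of \<open>f w\<close>
  along \<open>f y\<close> is known exactly, and comparing it with \<open>\<parallel>w\<parallel>\<close> bounds \<open>\<parallel>y + \<rho>\<parallel>\<close> by \<open>\<parallel>\<rho>\<parallel> / s\<close>.
  When \<open>y = 0\<close> the claim reduces to \<open>s \<le> 1\<close>.
\<close>

lemma sketched_residual_le:
  fixes f :: "'a::real_inner \<Rightarrow> 'b::real_inner"
  assumes "linear f" and contraction: "\<And>z. norm (f z) \<le> norm z"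
    and orth: "y \<bullet> \<rho> = 0" and sketched_orth: "f (y + \<rho>) \<bullet> f y = 0"
    and lower: "s * norm y \<le> norm (f y)" and s: "0 \<le> s" "s \<le> 1"
  shows "s * norm (y + \<rho>) \<le> norm \<rho>"
proof (cases "y = 0")
  case True
  then show ?thesis using s by (simp add: mult_left_le_one_le)
next
  case False
  interpret linear f by fact
  define Y R N where "Y = (norm y)\<^sup>2" and "R = (norm \<rho>)\<^sup>2" and "N = norm (y + \<rho>)"
  have YRN: "0 < Y" "0 \<le> R" "N\<^sup>2 = R + Y"
    using False orth by (auto simp: Y_def R_def N_def power2_norm_eq_inner
        inner_add_left inner_add_right inner_commute)
  have N: "0 < N"
  proof -
    have "N \<noteq> 0" using YRN by auto
    then show ?thesis by (simp add: N_def)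
  qed
  define w where "w = R *\<^sub>R y - Y *\<^sub>R \<rho>"
  have "w \<bullet> w = R * Y * (R + Y)"
  proof -
    have "w \<bullet> w = R\<^sup>2 * (y \<bullet> y) + Y\<^sup>2 * (\<rho> \<bullet> \<rho>)"
      using orth by (simp add: w_def inner_diff_left inner_diff_right inner_commute[of \<rho> y]
          power2_eq_square)
    also have "y \<bullet> y = Y" by (simp add: Y_def power2_norm_eq_inner)
    also have "\<rho> \<bullet> \<rho> = R" by (simp add: R_def power2_norm_eq_inner)
    finally show ?thesis by (simp add: power2_eq_square algebra_simps)
  qed
  then have "(norm w)\<^sup>2 = (norm \<rho> * norm y * N)\<^sup>2"
    using YRN by (simp add: power2_norm_eq_inner power_mult_distrib Y_def R_def)
  then have norm_w: "norm w = norm \<rho> * norm y * N"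
    by (simp add: power2_eq_iff_nonneg N_def)
  have "f w \<bullet> f y = R * (f y \<bullet> f y) - Y * (f \<rho> \<bullet> f y)"
    by (simp add: w_def diff scale inner_diff_left)
  also have "f \<rho> \<bullet> f y = - (f y \<bullet> f y)"
    using sketched_orth by (simp add: add inner_add_left)
  finally have "f w \<bullet> f y = N\<^sup>2 * (norm (f y))\<^sup>2"
    unfolding YRN by (simp add: power2_norm_eq_inner algebra_simps)
  then have "N\<^sup>2 * norm (f y) * norm (f y) \<le> norm (f w) * norm (f y)"
    using norm_cauchy_schwarz[of "f w" "f y"] by (simp add: power2_eq_square mult.assoc)
  then have "N\<^sup>2 * norm (f y) \<le> norm (f w)"
    by (cases "f y = 0") auto
  moreover have "N\<^sup>2 * (s * norm y) \<le> N\<^sup>2 * norm (f y)"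
    by (intro mult_left_mono lower) simp
  moreover note contraction[of w]
  ultimately have "N\<^sup>2 * (s * norm y) \<le> norm \<rho> * norm y * N"
    unfolding norm_w by linarith
  then have "(s * N) * (norm y * N) \<le> norm \<rho> * (norm y * N)"
    by (simp add: power2_eq_square algebra_simps)
  then show ?thesis
    using N False by (simp add: N_def mult_le_cancel_right)
qed

text \<open>
  Stability of a lower bound for a contraction under a change of the subspace. The vector \<open>z\<close> is
  the point \<open>B(p\<^sub>0) x\<close> of the old subspace and \<open>e\<close> the displacement.
\<close>

lemma contraction_lower_bound_perturbed:
  fixes f :: "'a::real_normed_vector \<Rightarrow> 'b::real_normed_vector"
  assumes "linear f" and contraction: "\<And>z. norm (f z) \<le> norm z"
    and lower: "\<sigma> * norm z \<le> norm (f z)" and \<sigma>: "\<sigma> \<le> 1" "3 / m * \<delta> < \<sigma>"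
    and z: "m * \<xi> \<le> norm z" and e: "norm e \<le> \<delta> * \<xi>"
    and pos: "0 < m" "0 \<le> \<delta>" "0 \<le> \<xi>"
  shows "(\<sigma> - 3 / m * \<delta>) * norm (z + e) \<le> norm (f (z + e))"
proof -
  interpret linear f by fact
  have \<sigma>0: "0 < \<sigma>" using \<sigma>(2) pos by (smt (verit) divide_nonneg_pos mult_nonneg_nonneg)
  have "3 * \<delta> < m"
  proof -
    have "3 / m * \<delta> < 1" using \<sigma> by linarith
    then show ?thesis using pos by (simp add: field_simps)
  qed
  then have "(2 * m) * \<xi> \<le> (3 * (m - \<delta>)) * \<xi>"
    using pos by (intro mult_right_mono) auto
  moreover have "norm z - norm e \<le> norm (z + e)"
    by (rule norm_diff_ineq)
  ultimately have x: "2 * m * \<xi> \<le> 3 * norm (z + e)"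
    using z e by (simp add: algebra_simps)
  have cost: "2 * (\<delta> * \<xi>) \<le> 3 / m * \<delta> * norm (z + e)"
  proof -
    have "\<delta> / m * (2 * m * \<xi>) \<le> \<delta> / m * (3 * norm (z + e))"
      using x pos by (intro mult_left_mono) auto
    then show ?thesis using pos by (simp add: field_simps)
  qed
  have "\<sigma> * norm (z + e) \<le> \<sigma> * (norm z + norm e)"
    using \<sigma>0 by (intro mult_left_mono norm_triangle_ineq) auto
  also have "\<dots> \<le> norm (f z) + norm e"
    using lower \<sigma> mult_right_mono[of \<sigma> 1 "norm e"] by (simp add: distrib_left)
  also have "norm (f z) \<le> norm (f (z + e)) + norm (f e)"
    using norm_diff_ineq[of "f z" "f e"] by (simp add: add)
  finally have "\<sigma> * norm (z + e) \<le> norm (f (z + e)) + 2 * (\<delta> * \<xi>)"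
    using contraction[of e] e by linarith
  with cost show ?thesis by (simp add: left_diff_distrib)
qed

theorem theorem5p2:
  fixes \<Omega> :: "(real^'d) set"
    and A :: "real^'d \<Rightarrow> real^'n^'n"
    and b :: "real^'d \<Rightarrow> real^'n"
    and Q_X :: "real^'r^'n"
    and B :: "real^'d \<Rightarrow> real^'r^'n"
    and S :: "real^'n^'s"
    and p0 p_star :: "real^'d"
    and U0 :: "real^'r^'n"
    and H0 :: "real^'r^'r"
    and c c_hat :: "real^'r"
    and C \<delta> :: real
  assumes "1 \<le> CARD('r)" and "CARD('r) \<le> CARD('n)"
    and "CARD('r) \<le> CARD('s)" and "CARD('s) < CARD('n)"
    and "bounded \<Omega>"
    and "orthonormal_columns Q_X"
    and "\<And>p. p \<in> \<Omega> \<Longrightarrow> B p = A p ** Q_X"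
    and "subsampling_matrix S"
    and "p0 \<in> \<Omega>"
    and "full_column_rank (A p0 ** Q_X)"
    and "polar_decomposition (B p0) U0 H0"
    and "p_star \<in> \<Omega>"
    and "onorm ((*v) (A p_star - A p0)) \<le> \<delta>"
    and "is_arg_min (\<lambda>x. norm (B p_star *v x - b p_star)) (\<lambda>_. True) c"
    and "is_arg_min (\<lambda>x. norm (S *v (B p_star *v x - b p_star))) (\<lambda>_. True) c_hat"
    and "C = 3 / sigma_min (A p0 ** Q_X)"
    and "sigma_min (S ** U0) > C * \<delta>"
  shows "if norm (B p_star *v c - b p_star) = 0
         then norm (B p_star *v c_hat - b p_star)
                \<le> 1 / (sigma_min (S ** U0) - C * \<delta>) * norm (B p_star *v c - b p_star)
         else norm (B p_star *v c_hat - b p_star) / norm (B p_star *v c - b p_star)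
                \<le> 1 / (sigma_min (S ** U0) - C * \<delta>)"
proof -
  let ?\<sigma> = "sigma_min (S ** U0)" and ?m = "sigma_min (A p0 ** Q_X)"
  define s where "s = ?\<sigma> - C * \<delta>"
  define \<rho> where "\<rho> = B p_star *v c - b p_star"
  define y where "y = B p_star *v (c_hat - c)"
  have B: "B p0 = A p0 ** Q_X" "B p_star = A p_star ** Q_X"
    using assms(7,9,12) by auto
  have U0: "B p0 = U0 ** H0" "orthonormal_columns U0"
    using assms(11) by (auto simp: polar_decomposition_def)
  have linear: "linear ((*v) S)" by simp
  note contraction = norm_subsampling_matrix_le[OF assms(8)]
  have m: "0 < ?m" by (rule sigma_min_pos) fact
  have \<delta>: "0 \<le> \<delta>"
    using assms(13) onorm_pos_le[OF matrix_vector_mul_bounded_linear, of "A p_star - A p0"]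
    by linarith
  have \<sigma>: "?\<sigma> \<le> 1"
    by (rule sigma_min_le_1)
      (metis contraction matrix_vector_mul_assoc norm_orthonormal_columns[OF U0(2)])
  have "0 \<le> C * \<delta>" using m \<delta> by (simp add: assms(16))
  then have s: "0 < s" "s \<le> 1"
    using assms(17) \<sigma> by (auto simp: s_def)
  have split: "B p_star *v x = B p0 *v x + (A p_star - A p0) *v (Q_X *v x)" for x
    unfolding B by (simp add: matrix_vector_mult_diff_rdistrib flip: matrix_vector_mul_assoc)
  have lower: "s * norm (B p_star *v x) \<le> norm (S *v (B p_star *v x))" for x
    unfolding s_def assms(16) split
  proof (rule contraction_lower_bound_perturbed[OF linear contraction])
    have "?\<sigma> * norm (H0 *v x) \<le> norm ((S ** U0) *v (H0 *v x))"
      by (rule sigma_min_norm_le)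
    also have "norm (H0 *v x) = norm (B p0 *v x)"
      by (simp add: U0(1) norm_orthonormal_columns[OF U0(2)] flip: matrix_vector_mul_assoc)
    also have "(S ** U0) *v (H0 *v x) = S *v (B p0 *v x)"
      by (simp add: U0(1) flip: matrix_vector_mul_assoc)
    finally show "?\<sigma> * norm (B p0 *v x) \<le> norm (S *v (B p0 *v x))" .
    show "?m * norm x \<le> norm (B p0 *v x)"
      unfolding B by (rule sigma_min_norm_le)
    show "norm ((A p_star - A p0) *v (Q_X *v x)) \<le> \<delta> * norm x"
      using norm_matrix_vector_le[OF assms(13), of "Q_X *v x"]
      by (simp add: norm_orthonormal_columns[OF assms(6)])
  qed (use \<sigma> m \<delta> assms(16,17) in auto)
  have residual: "B p_star *v c_hat - b p_star = y + \<rho>"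
    by (simp add: y_def \<rho>_def matrix_vector_mult_diff_distrib)
  have "s * norm (y + \<rho>) \<le> norm \<rho>"
  proof (rule sketched_residual_le[OF linear contraction])
    show "y \<bullet> \<rho> = 0"
      using least_squares_residual_orthogonal[OF assms(14), of "c_hat - c"]
      by (simp add: y_def \<rho>_def inner_commute)
    have "is_arg_min (\<lambda>x. norm ((S ** B p_star) *v x - S *v b p_star)) (\<lambda>_. True) c_hat"
      using assms(15)
      by (simp add: matrix_vector_mult_diff_distrib flip: matrix_vector_mul_assoc)
    from least_squares_residual_orthogonal[OF this, of "c_hat - c"]
    show "(S *v (y + \<rho>)) \<bullet> (S *v y) = 0"
      unfolding residual[symmetric]
      by (simp add: y_def matrix_vector_mult_diff_distrib flip: matrix_vector_mul_assoc)
    show "s * norm y \<le> norm (S *v y)"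
      unfolding y_def by (rule lower)
  qed (use s in auto)
  then have bound: "norm (y + \<rho>) \<le> 1 / s * norm \<rho>"
    using s by (simp add: field_simps)
  then have "norm (y + \<rho>) / norm \<rho> \<le> 1 / s" if "norm \<rho> \<noteq> 0"
    using that by (simp add: divide_le_eq)
  with bound show ?thesis
    unfolding residual \<rho>_def[symmetric] s_def[symmetric] by presburger
qed

end
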